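(* Let $n>1$ be an integer with $n\equiv1\pmod4$. Then $n$ is not a sum of two squares of integers if and only if $$\sum_{x=0}^{n-1}\left(\frac{x(x^2+1)}n\right)=0.$$
   Context: $\left(\frac{\cdot}{n}\right)$ denotes the Jacobi symbol modulo the odd integer $n$ (equal to $0$ on integers not coprime to $n$). *)

theory Defs
  imports "HOL-Number_Theory.Number_Theory"
begin

text \<open>
  The Jacobi symbol: the product of the Legendre symbols of \<open>a\<close> at the prime factors of \<open>n\<close>,
  counted with multiplicity. It is meaningful for odd positive \<open>n\<close> only (at \<open>p = 2\<close> the
  library's \<open>Legendre\<close> is not the Kronecker symbol). Since \<open>Legendre a p = 0\<close> for \<open>p dvd a\<close>,
  it vanishes when \<open>a\<close> and \<open>n\<close> are not coprime.
\<close>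

definition Jacobi :: "int \<Rightarrow> int \<Rightarrow> int" where
  "Jacobi a n = (\<Prod>p \<in># prime_factorization n. Legendre a p)"

end

theory Submission
  imports Defs "HOL-Library.Discrete_Functions"
begin

text \<open>
  By the Chinese remainder theorem the sum is multiplicative in \<open>n\<close>, and over a prime power \<open>p\<^sup>k\<close>
  it is \<open>p\<^bsup>k-1\<^esup>\<close> times the sum of the \<open>k\<close>-th powers of \<open>f x = (x(x\<^sup>2+1)/p)\<close> over
  the residues modulo \<open>p\<close>. For even \<open>k\<close> the summands are nonnegative and the one at \<open>x = 1\<close> is \<open>1\<close>.
  For odd \<open>k\<close> use \<open>f (-x) = (-1/p) f x\<close>: if \<open>p \<equiv> 3 (mod 4)\<close> everything cancels, whereas if
  \<open>p \<equiv> 1 (mod 4)\<close> the sum is twice the sum over \<open>1 \<le> x \<le> (p - 1)/2\<close>, in which exactly one of the evenly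
  many summands vanishes and the others are \<open>\<plusminus>1\<close>; so it is twice an odd number. Hence the sum
  vanishes if and only if some prime \<open>p \<equiv> 3 (mod 4)\<close> has odd multiplicity in \<open>n\<close>, which is the two
  squares criterion.
\<close>

section \<open>The Legendre symbol\<close>

lemma Legendre_cong:
  assumes "[a = b] (mod p)"
  shows "Legendre a p = Legendre b p"
proof -
  have "[c = a] (mod p) \<longleftrightarrow> [c = b] (mod p)" for c
    using assms cong_sym cong_trans by blast
  moreover have "[a = 0] (mod p) \<longleftrightarrow> [b = 0] (mod p)"
    using assms cong_sym cong_trans by blast
  ultimately show ?thesis
    by (simp add: Legendre_def QuadRes_def)
qed

lemma Legendre_cases: "Legendre a p \<in> {-1, 0, 1}"
  by (auto simp: Legendre_def)

lemma Legendre_eq_0_iff: "Legendre a p = 0 \<longleftrightarrow> p dvd a"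
  by (auto simp: Legendre_def cong_0_iff)

lemma Legendre_square:
  assumes "prime p" "\<not> p dvd a"
  shows "Legendre (a\<^sup>2) p = 1"
proof -
  have "QuadRes p (a\<^sup>2)"
    unfolding QuadRes_def by (rule exI[of _ a]) simp
  moreover have "\<not> p dvd a\<^sup>2"
    using assms prime_dvd_power by blast
  ultimately show ?thesis
    by (simp add: Legendre_def cong_0_iff)
qed

text \<open>Euler's criterion gives the identity modulo \<open>p\<close>. Both sides lie between -1
  and 1, so they differ by at most 2, which is less than \<open>p\<close>, and the congruence is an
  equality.\<close>

lemma Legendre_minus:
  fixes p :: int
  assumes "prime p" "2 < p"
  shows "Legendre (- a) p = (-1) ^ nat ((p - 1) div 2) * Legendre a p"
proof -
  define h where "h = (nat p - 1) div 2"
  have p: "prime (nat p)" "2 < nat p" "int (nat p) = p"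
    using assms by auto
  have h: "nat ((p - 1) div 2) = h"
    using assms by (simp add: h_def nat_div_distrib nat_diff_distrib)
  have "[Legendre (- a) p = (- a) ^ h] (mod p)" "[Legendre a p = a ^ h] (mod p)"
    using euler_criterion[OF p(1,2)] p(3) by (auto simp: h_def)
  moreover have "(- a) ^ h = (-1) ^ h * a ^ h"
    by (rule power_minus)
  ultimately have "[Legendre (- a) p = (-1) ^ h * Legendre a p] (mod p)"
    by (metis cong_scalar_left cong_sym cong_trans)
  then have "p dvd Legendre (- a) p - (-1) ^ h * Legendre a p"
    by (simp add: cong_iff_dvd_diff)
  moreover have "\<bar>Legendre (- a) p - (-1) ^ h * Legendre a p\<bar> < p"
    using Legendre_cases[of a p] Legendre_cases[of "- a" p] assms(2)
    by (cases "even h") auto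
  ultimately have "Legendre (- a) p - (-1) ^ h * Legendre a p = 0"
    by (metis dvd_imp_le_int not_le abs_of_pos assms(2) less_trans zero_less_numeral)
  then show ?thesis
    by (simp add: h)
qed

lemma Legendre_minus_1_mod_4:
  fixes p :: int
  assumes "prime p" "p mod 4 = 1"
  shows "Legendre (- a) p = Legendre a p"
proof -
  have "2 < p"
    using assms prime_gt_1_int[of p] by presburger
  moreover have "even (nat ((p - 1) div 2))"
    using assms \<open>2 < p\<close> by (simp add: even_nat_iff) presburger
  ultimately show ?thesis
    using Legendre_minus[of p a] assms by simp
qed

lemma Legendre_minus_3_mod_4:
  fixes p :: int
  assumes "prime p" "p mod 4 = 3"
  shows "Legendre (- a) p = - Legendre a p"
proof -
  have "2 < p"
    using assms prime_gt_1_int[of p] by presburger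
  moreover have "odd (nat ((p - 1) div 2))"
    using assms \<open>2 < p\<close> by (simp add: even_nat_iff) presburger
  ultimately show ?thesis
    using Legendre_minus[of p a] assms by simp
qed

lemma ex_square_plus_1_dvd:
  fixes p :: int
  assumes "prime p" "p mod 4 = 1"
  obtains s where "p dvd s\<^sup>2 + 1"
proof -
  have "\<not> p dvd 1"
    using assms by auto
  then have "Legendre (- 1) p = 1"
    using Legendre_minus_1_mod_4[OF assms, of 1] Legendre_square[OF assms(1), of 1] by simp
  then have "QuadRes p (- 1)"
    by (auto simp: Legendre_def split: if_splits)
  then show thesis
    using that by (auto simp: QuadRes_def cong_iff_dvd_diff)
qed

section \<open>Sums of two squares\<close>

definition sum_two_squares :: "int \<Rightarrow> bool" where
  "sum_two_squares n \<longleftrightarrow> (\<exists>a b. n = a\<^sup>2 + b\<^sup>2)"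

lemma sum_two_squares_mult:
  assumes "sum_two_squares m" "sum_two_squares n"
  shows "sum_two_squares (m * n)"
proof -
  obtain a b c d where "m = a\<^sup>2 + b\<^sup>2" "n = c\<^sup>2 + d\<^sup>2"
    using assms by (auto simp: sum_two_squares_def)
  then have "m * n = (a * c - b * d)\<^sup>2 + (a * d + b * c)\<^sup>2"
    by (simp add: power2_eq_square algebra_simps)
  then show ?thesis
    unfolding sum_two_squares_def by blast
qed

lemma sum_two_squares_square: "sum_two_squares (a\<^sup>2)"
  unfolding sum_two_squares_def by (metis add.right_neutral zero_power2)

lemma sum_two_squares_power:
  assumes "sum_two_squares m"
  shows "sum_two_squares (m ^ k)"
proof (induction k)
  case 0
  show ?case
    using sum_two_squares_square[of 1] by simp
next
  case (Suc k)
  then show ?case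
    using assms sum_two_squares_mult by simp
qed

text \<open>Otherwise \<open>p\<close> divides neither number, and the congruence of
  \<open>a\<^sup>2\<close> and \<open>- (b\<^sup>2)\<close> would equate the symbols 1 and -1, as -1
  is a nonresidue.\<close>

lemma dvd_sum_squares_3_mod_4:
  fixes p :: int
  assumes "prime p" "p mod 4 = 3" "p dvd a\<^sup>2 + b\<^sup>2"
  shows "p dvd a"
proof (rule ccontr)
  assume a: "\<not> p dvd a"
  have "\<not> p dvd b"
  proof
    assume "p dvd b"
    then have "p dvd a\<^sup>2"
      using assms(3) by (simp add: power2_eq_square dvd_add_left_iff)
    then show False
      using a assms(1) prime_dvd_power by blast
  qed
  have "Legendre (a\<^sup>2) p = Legendre (- (b\<^sup>2)) p"
    using assms(3) by (intro Legendre_cong) (simp add: cong_iff_dvd_diff)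
  then show False
    using a \<open>\<not> p dvd b\<close> assms Legendre_minus_3_mod_4[of p "b\<^sup>2"] Legendre_square by simp
qed

text \<open>Descent: if \<open>p\<close> divides \<open>n\<close>, it divides both \<open>a\<close>
  and \<open>b\<close>, so \<open>n\<close> divided by the square of \<open>p\<close> is a smaller
  sum of two squares whose multiplicity is lower by exactly 2.\<close>

lemma even_multiplicity_of_sum_two_squares:
  fixes p :: int
  assumes "prime p" "p mod 4 = 3" "sum_two_squares n" "n > 0"
  shows "even (multiplicity p n)"
  using assms(3,4)
proof (induction "nat n" arbitrary: n rule: less_induct)
  case less
  show ?case
  proof (cases "p dvd n")
    case False
    then show ?thesis
      by (simp add: not_dvd_imp_multiplicity_0)
  next
    case True
    obtain a b where n: "n = a\<^sup>2 + b\<^sup>2"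
      using less.prems by (auto simp: sum_two_squares_def)
    have "p dvd a" "p dvd b"
      using dvd_sum_squares_3_mod_4[OF assms(1,2)] True n by (metis add.commute)+
    then obtain c d where cd: "a = p * c" "b = p * d"
      by (elim dvdE)
    define m where "m = c\<^sup>2 + d\<^sup>2"
    have nm: "n = p * (p * m)"
      unfolding n cd m_def by (simp add: power2_eq_square algebra_simps)
    have p: "p > 1"
      using assms prime_gt_1_int by blast
    have "m > 0"
      using less.prems(2) nm p by (metis zero_less_mult_pos zero_less_one order_less_trans)
    moreover have "m < n"
    proof -
      have "m < p * m"
        using p \<open>m > 0\<close> by simp
      also have "\<dots> < p * (p * m)"
        using p \<open>m > 0\<close> by simp
      finally show ?thesis
        by (simp only: nm)
    qed
    moreover have "sum_two_squares m"
      unfolding sum_two_squares_def m_def by blast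
    ultimately have "even (multiplicity p m)"
      by (intro less.hyps) simp_all
    then show ?thesis
      using p \<open>m > 0\<close> unfolding nm by (simp add: multiplicity_times_same)
  qed
qed

text \<open>
  Thue's argument: for \<open>s\<^sup>2 \<equiv> -1\<close>, two of the numbers \<open>x + s y\<close> with \<open>0 \<le> x, y \<le> \<surd>p\<close> agree modulo \<open>p\<close>;
  the differences \<open>u, v\<close> of their coordinates satisfy \<open>p dvd u\<^sup>2 + v\<^sup>2\<close> and \<open>0 < u\<^sup>2 + v\<^sup>2 < 2 p\<close>.
\<close>

lemma sum_two_squares_prime:
  fixes p :: int
  assumes "prime p" "p mod 4 = 1"
  shows "sum_two_squares p"
proof -
  obtain s where s: "p dvd s\<^sup>2 + 1"
    using ex_square_plus_1_dvd[OF assms] .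
  have p: "p > 1"
    using assms prime_gt_1_int by blast
  define r where "r = int (floor_sqrt (nat p))"
  have r0: "r \<ge> 0"
    by (simp add: r_def)
  have "int ((floor_sqrt (nat p))\<^sup>2) \<le> int (nat p)"
    by (subst of_nat_le_iff) simp
  then have "r\<^sup>2 \<le> p"
    using p by (simp add: r_def)
  \<comment> \<open>A prime is not a square; the strict inequality is what later makes
    \<open>u\<^sup>2 + v\<^sup>2\<close> strictly less than \<open>2 * p\<close>.\<close>
  moreover have "r\<^sup>2 \<noteq> p"
    using assms(1) by (auto simp: prime_power_iff)
  ultimately have rp: "r\<^sup>2 < p"
    by simp
  \<comment> \<open>For the pigeonhole count: the grid \<open>?A\<close> has
    \<open>(r + 1)\<^sup>2\<close> points, more than there are residues.\<close>
  have "int (nat p) < int ((Suc (floor_sqrt (nat p)))\<^sup>2)"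
    by (subst of_nat_less_iff) (rule Suc_floor_sqrt_power2_gt)
  then have pr: "p < (r + 1)\<^sup>2"
    using p by (simp add: r_def add.commute)
  let ?A = "{0..r} \<times> {0..r}" and ?g = "\<lambda>(x, y). (x + s * y) mod p"
  have "\<not> inj_on ?g ?A"
  proof
    assume "inj_on ?g ?A"
    moreover have "?g ` ?A \<subseteq> {0..<p}"
      using p by auto
    ultimately have "card ?A \<le> card {0..<p}"
      by (intro card_inj_on_le) auto
    then have "nat ((r + 1) * (r + 1)) \<le> nat p"
      using r0 by (simp add: card_cartesian_product nat_mult_distrib)
    then show False
      using pr p r0 by (simp add: power2_eq_square)
  qed
  then obtain x y x' y' where xy: "x \<in> {0..r}" "y \<in> {0..r}" "x' \<in> {0..r}" "y' \<in> {0..r}"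
    "(x, y) \<noteq> (x', y')" "(x + s * y) mod p = (x' + s * y') mod p"
    by (auto simp: inj_on_def)
  define u v where "u = x - x'" and "v = y - y'"
  have "\<bar>u\<bar> \<le> \<bar>r\<bar>" "\<bar>v\<bar> \<le> \<bar>r\<bar>"
    using xy r0 by (auto simp: u_def v_def)
  then have "u\<^sup>2 \<le> r\<^sup>2" "v\<^sup>2 \<le> r\<^sup>2"
    by (simp_all only: abs_le_square_iff)
  then have less: "u\<^sup>2 + v\<^sup>2 < 2 * p"
    using rp by linarith
  have pos: "u\<^sup>2 + v\<^sup>2 > 0"
    using xy(5) by (auto simp: u_def v_def sum_power2_gt_zero_iff)
  have "p dvd u + s * v"
    using xy(6) by (simp add: mod_eq_dvd_iff u_def v_def algebra_simps)
  then have "p dvd (u + s * v) * (u - s * v) + v\<^sup>2 * (s\<^sup>2 + 1)"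
    using s by (meson dvd_add dvd_mult dvd_mult2)
  also have "(u + s * v) * (u - s * v) + v\<^sup>2 * (s\<^sup>2 + 1) = u\<^sup>2 + v\<^sup>2"
    by (simp add: power2_eq_square algebra_simps)
  finally obtain k where k: "u\<^sup>2 + v\<^sup>2 = p * k"
    by (elim dvdE)
  then have "k > 0" "k < 2"
    using pos less p by (auto simp: zero_less_mult_iff)
  then have "k = 1"
    by simp
  then show ?thesis
    using k unfolding sum_two_squares_def by (metis mult.right_neutral)
qed

section \<open>Induction over prime powers and the two squares criterion\<close>

text \<open>Each step splits off the full power of a prime, so that the two factors are coprime and
  multiplicativity over coprime factors can be applied.\<close>

lemma int_prime_power_induct [consumes 1, case_names 1 mult]:
  fixes n :: int
  assumes "n > 0"
    and "P 1"
    and step: "\<And>p k m. prime p \<Longrightarrow> k > 0 \<Longrightarrow> m > 0 \<Longrightarrow> \<not> p dvd m \<Longrightarrow> P m \<Longrightarrow> P (p ^ k * m)"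
  shows "P n"
  using assms(1)
proof (induction "nat n" arbitrary: n rule: less_induct)
  case less
  show ?case
  proof (cases "n = 1")
    case True
    then show ?thesis
      using assms(2) by simp
  next
    case False
    then have "\<not> is_unit n"
      using less.prems by auto
    then obtain p where p: "prime p" "p dvd n"
      using less.prems prime_divisor_exists[of n] by auto
    define k where "k = multiplicity p n"
    obtain m where m: "n = p ^ k * m" "\<not> p dvd m"
      unfolding k_def using less.prems p(1) multiplicity_decompose'[of n p]
      by (metis less_irrefl not_prime_unit)
    have k: "k > 0"
      using p less.prems by (metis k_def gr0I m mult_1 power_0)
    have "1 < p ^ k"
      using k prime_gt_1_int[OF p(1)] by (simp add: one_less_power)
    moreover from this have "m > 0"
      using less.prems m(1) by (metis not_less order_less_trans zero_less_mult_pos zero_less_one)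
    ultimately have "m < n"
      using m(1) by simp
    then show ?thesis
      using step[OF p(1) k \<open>m > 0\<close> m(2)] less.hyps[of m] \<open>m > 0\<close> m(1) by simp
  qed
qed

text \<open>The condition that links the two sides of the theorem: being a sum of two squares and
  having a nonzero character sum are each shown equivalent to it for odd
  \<open>n > 0\<close>.\<close>

definition even_mult_3_mod_4 :: "int \<Rightarrow> bool" where
  "even_mult_3_mod_4 n \<longleftrightarrow> (\<forall>p. prime p \<and> p mod 4 = 3 \<longrightarrow> even (multiplicity p n))"

lemma even_mult_3_mod_4_prime_power_mult:
  fixes p m :: int
  assumes "prime p" "m > 0" "\<not> p dvd m"
  shows "even_mult_3_mod_4 (p ^ k * m) \<longleftrightarrow> (p mod 4 = 3 \<longrightarrow> even k) \<and> even_mult_3_mod_4 m"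
proof -
  have *: "multiplicity q (p ^ k * m) = (if q = p then k else multiplicity q m)" if "prime q" for q
  proof -
    have "multiplicity q (p ^ k * m) = multiplicity q (p ^ k) + multiplicity q m"
      using that assms by (intro prime_elem_multiplicity_mult_distrib) auto
    then show ?thesis
      using that assms(1,3)
      by (auto simp: multiplicity_distinct_prime_power not_dvd_imp_multiplicity_0)
  qed
  have "multiplicity p m = 0"
    using assms(3) by (rule not_dvd_imp_multiplicity_0)
  then show ?thesis
    using assms(1) by (auto simp: even_mult_3_mod_4_def *)
qed

theorem sum_two_squares_iff:
  assumes "n > 0" "odd n"
  shows "sum_two_squares n \<longleftrightarrow> even_mult_3_mod_4 n"
proof
  assume "sum_two_squares n"
  then show "even_mult_3_mod_4 n"
    using assms even_multiplicity_of_sum_two_squares by (auto simp: even_mult_3_mod_4_def)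
next
  assume "even_mult_3_mod_4 n"
  with assms show "sum_two_squares n"
  proof (induction rule: int_prime_power_induct)
    case 1
    show ?case
      using sum_two_squares_square[of 1] by simp
  next
    case (mult p k m)
    have "odd p" "odd m"
      using mult.prems mult.hyps by auto
    have *: "p mod 4 = 3 \<longrightarrow> even k" "even_mult_3_mod_4 m"
      using mult.prems mult.hyps even_mult_3_mod_4_prime_power_mult by auto
    have "sum_two_squares (p ^ k)"
    proof (cases "p mod 4 = 1")
      case True
      then show ?thesis
        using mult.hyps sum_two_squares_prime sum_two_squares_power by blast
    next
      case False
      then have "p mod 4 = 3"
        using \<open>odd p\<close> by presburger
      \<comment> \<open>Such a prime need not be a sum of two squares itself, but its exponent is
        even, so the prime power is a square.\<close>
      then have "p ^ k = (p ^ (k div 2))\<^sup>2"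
        using * by (simp flip: power_mult)
      then show ?thesis
        using sum_two_squares_square by simp
    qed
    then show ?case
      using sum_two_squares_mult mult.IH \<open>odd m\<close> *(2) by blast
  qed
qed

section \<open>The character sum\<close>

lemma Jacobi_mult:
  assumes "m > 0" "n > 0"
  shows "Jacobi a (m * n) = Jacobi a m * Jacobi a n"
  using assms by (simp add: Jacobi_def prime_factorization_mult)

lemma Jacobi_prime_power:
  assumes "prime p"
  shows "Jacobi a (p ^ k) = Legendre a p ^ k"
  using assms by (simp add: Jacobi_def prime_factorization_prime_power)

lemma Jacobi_cong:
  assumes "[a = b] (mod n)"
  shows "Jacobi a n = Jacobi b n"
proof -
  have "Legendre a p = Legendre b p" if "p \<in># prime_factorization n" for p
    using that assms by (intro Legendre_cong cong_dvd_modulus[OF assms]) auto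
  then show ?thesis
    unfolding Jacobi_def by (intro arg_cong[of _ _ prod_mset] image_mset_cong)
qed

definition cubic :: "int \<Rightarrow> int" where
  "cubic x = x * (x\<^sup>2 + 1)"

lemma cubic_cong: "[x = y] (mod n) \<Longrightarrow> [cubic x = cubic y] (mod n)"
  unfolding cubic_def by (intro cong_mult cong_add cong_pow cong_refl)

lemma cubic_minus: "cubic (- x) = - cubic x"
  by (simp add: cubic_def)

definition cubic_sum :: "int \<Rightarrow> int" where
  "cubic_sum n = (\<Sum>x\<in>{0..<n}. Jacobi (cubic x) n)"

section \<open>Multiplicativity and reduction to residues modulo a prime\<close>

text \<open>Coprimality gives injectivity; surjectivity follows because both finite sets have
  \<open>m * n\<close> elements.\<close>

lemma bij_betw_chinese_remainder:
  fixes m n :: int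
  assumes "m > 0" "n > 0" "coprime m n"
  shows "bij_betw (\<lambda>x. (x mod m, x mod n)) {0..<m * n} ({0..<m} \<times> {0..<n})"
proof -
  have "inj_on (\<lambda>x. (x mod m, x mod n)) {0..<m * n}"
  proof (rule inj_onI)
    fix x y
    assume xy: "x \<in> {0..<m * n}" "y \<in> {0..<m * n}" "(x mod m, x mod n) = (y mod m, y mod n)"
    then have "[x = y] (mod m * n)"
      by (intro coprime_cong_mult assms) (auto simp: cong_def)
    then show "x = y"
      using xy cong_less_imp_eq_int by auto
  qed
  moreover have "(\<lambda>x. (x mod m, x mod n)) ` {0..<m * n} \<subseteq> {0..<m} \<times> {0..<n}"
    using assms by auto
  moreover have "card {0..<m * n} = card ({0..<m} \<times> {0..<n})"
    using assms by (simp add: card_cartesian_product nat_mult_distrib)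
  ultimately show ?thesis
    unfolding bij_betw_def by (intro conjI card_subset_eq) (simp_all only: card_image finite_SigmaI finite_atLeastLessThan_int)
qed

lemma cubic_sum_mult:
  assumes "m > 0" "n > 0" "coprime m n"
  shows "cubic_sum (m * n) = cubic_sum m * cubic_sum n"
proof -
  have mod: "Jacobi (cubic (x mod d)) d = Jacobi (cubic x) d" for x d
    by (intro Jacobi_cong cubic_cong) simp
  have "cubic_sum (m * n) = (\<Sum>x\<in>{0..<m * n}.
      (\<lambda>(y, z). Jacobi (cubic y) m * Jacobi (cubic z) n) (x mod m, x mod n))"
    using assms by (simp add: cubic_sum_def Jacobi_mult mod)
  also have "\<dots> = (\<Sum>(y, z)\<in>{0..<m} \<times> {0..<n}. Jacobi (cubic y) m * Jacobi (cubic z) n)"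
    by (rule sum.reindex_bij_betw[OF bij_betw_chinese_remainder[OF assms]])
  also have "\<dots> = cubic_sum m * cubic_sum n"
    by (simp add: cubic_sum_def sum_product sum.cartesian_product)
  finally show ?thesis .
qed

lemma sum_periodic:
  fixes p :: int and g :: "int \<Rightarrow> int"
  assumes "p > 0" and per: "\<And>x. g (x + p) = g x"
  shows "(\<Sum>x\<in>{0..<p * int m}. g x) = int m * (\<Sum>x\<in>{0..<p}. g x)"
proof (induction m)
  case (Suc m)
  have g: "g (x + p * int j) = g x" for x j
  proof (induction j)
    case (Suc j)
    then show ?case
      using per[of "x + p * int j"] by (simp add: algebra_simps)
  qed simp
  have "{0..<p * int (Suc m)} = {0..<p * int m} \<union> {p * int m..<p * int m + p}"
    using assms(1) by (simp add: ivl_disj_un_two(3) algebra_simps)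
  then have "(\<Sum>x\<in>{0..<p * int (Suc m)}. g x) =
      (\<Sum>x\<in>{0..<p * int m}. g x) + (\<Sum>x\<in>{p * int m..<p * int m + p}. g x)"
    by (simp add: sum.union_disjoint)
  also have "(\<Sum>x\<in>{p * int m..<p * int m + p}. g x) = (\<Sum>x\<in>{0..<p}. g x)"
    by (rule sum.reindex_bij_witness[of _ "\<lambda>x. x + p * int m" "\<lambda>x. x - p * int m"])
      (use g[of "_ - p * int m" m] in \<open>auto simp: g\<close>)
  finally show ?case
    using Suc by (simp add: algebra_simps)
qed simp

lemma cubic_sum_prime_power:
  assumes "prime p" "k > 0"
  shows "cubic_sum (p ^ k) = p ^ (k - 1) * (\<Sum>x\<in>{0..<p}. Legendre (cubic x) p ^ k)"
proof -
  have p: "p > 0"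
    using assms prime_gt_0_int by blast
  \<comment> \<open>The range is a whole number of periods of length \<open>p\<close>, in the shape
    that \<open>sum_periodic\<close> expects.\<close>
  have pk: "p ^ k = p * int (nat p ^ (k - 1))"
    using p assms(2) by (cases k) auto
  have "cubic_sum (p ^ k) = (\<Sum>x\<in>{0..<p ^ k}. Legendre (cubic x) p ^ k)"
    using assms by (simp add: cubic_sum_def Jacobi_prime_power)
  also have "\<dots> = int (nat p ^ (k - 1)) * (\<Sum>x\<in>{0..<p}. Legendre (cubic x) p ^ k)"
  proof -
    have "Legendre (cubic (x + p)) p = Legendre (cubic x) p" for x
      by (intro Legendre_cong cubic_cong) (simp add: cong_def)
    then show ?thesis
      unfolding pk by (intro sum_periodic p) simp
  qed
  finally show ?thesis
    using p by simp
qed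

section \<open>Power sums of Legendre symbols modulo a prime\<close>

lemma sum_Legendre_cubic_even_power:
  fixes p :: int
  assumes "prime p" "odd p" "even k"
  shows "(\<Sum>x\<in>{0..<p}. Legendre (cubic x) p ^ k) > 0"
proof (rule sum_pos2)
  have p: "p > 1"
    using assms prime_gt_1_int by blast
  then show "1 \<in> {0..<p}"
    by simp
  \<comment> \<open>The value \<open>cubic 1\<close> is 2, which is invertible modulo an odd
    prime.\<close>
  have "\<not> p dvd 2"
    using assms p zdvd_imp_le[of p 2] by (cases "p = 2") auto
  then have "Legendre (cubic 1) p \<noteq> 0"
    by (simp add: Legendre_eq_0_iff cubic_def)
  then show "0 < Legendre (cubic 1) p ^ k"
    using assms(3) by (simp add: zero_less_power_eq)
  show "0 \<le> Legendre (cubic x) p ^ k" for x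
    using assms(3) by (rule zero_le_even_power)
qed simp

lemma Legendre_odd_power:
  assumes "odd k"
  shows "Legendre a p ^ k = Legendre a p"
proof -
  consider "Legendre a p = -1" | "Legendre a p = 0" | "Legendre a p = 1"
    using Legendre_cases by blast
  then show ?thesis
    by cases (use assms in \<open>simp_all add: odd_pos\<close>)
qed

text \<open>Substitute \<open>p - x\<close> for \<open>x\<close> and use that \<open>cubic\<close>
  is odd. The sign stays inside the symbol so that both classes of \<open>p\<close> modulo 4 are
  served, and the interval is arbitrary so that the whole range and a half range can both be
  reflected.\<close>

lemma sum_Legendre_cubic_reflect:
  fixes p a b :: int
  shows "(\<Sum>x\<in>{a..b}. Legendre (cubic x) p) = (\<Sum>x\<in>{p - b..p - a}. Legendre (- cubic x) p)"
proof -
  have *: "Legendre (- cubic (p - x)) p = Legendre (cubic x) p" for x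
  proof (rule Legendre_cong)
    have "[p - x = - x] (mod p)"
      by (simp add: cong_iff_dvd_diff)
    then have "[cubic (p - x) = cubic (- x)] (mod p)"
      by (rule cubic_cong)
    then show "[- cubic (p - x) = cubic x] (mod p)"
      by (simp add: cubic_minus cong_minus_minus_iff[of "cubic (p - x)", symmetric])
  qed
  show ?thesis
    by (rule sum.reindex_bij_witness[of _ "\<lambda>x. p - x" "\<lambda>x. p - x"]) (simp_all add: *)
qed

text \<open>Dropping the zero term at 0 leaves a range that is symmetric under the reflection of
  \<open>x\<close> to \<open>p - x\<close>.\<close>

lemma sum_Legendre_cubic_residues:
  fixes p :: int
  assumes "p > 0"
  shows "(\<Sum>x\<in>{0..<p}. Legendre (cubic x) p) = (\<Sum>x\<in>{1..p - 1}. Legendre (cubic x) p)"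
proof (rule sum.mono_neutral_right)
  have "{0..<p} - {1..p - 1} \<subseteq> {0}"
    by auto
  moreover have "Legendre (cubic 0) p = 0"
    by (simp add: cubic_def Legendre_eq_0_iff)
  ultimately show "\<forall>x\<in>{0..<p} - {1..p - 1}. Legendre (cubic x) p = 0"
    by blast
qed auto

lemma sum_Legendre_cubic_3_mod_4:
  fixes p :: int
  assumes "prime p" "p mod 4 = 3"
  shows "(\<Sum>x\<in>{0..<p}. Legendre (cubic x) p) = 0"
proof -
  let ?S = "\<Sum>x\<in>{1..p - 1}. Legendre (cubic x) p"
  have "?S = (\<Sum>x\<in>{1..p - 1}. Legendre (- cubic x) p)"
    by (subst sum_Legendre_cubic_reflect[of p]) simp
  also have "\<dots> = - ?S"
    using assms by (simp add: Legendre_minus_3_mod_4 sum_negf)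
  finally have "?S = 0"
    by linarith
  then show ?thesis
    using sum_Legendre_cubic_residues[of p] assms prime_gt_0_int by simp
qed

text \<open>The square roots of -1 modulo \<open>p\<close> form a pair \<open>t\<close>,
  \<open>p - t\<close>, and exactly one of the two lies in the lower half.\<close>

lemma ex1_half_square_plus_1_dvd:
  fixes p :: int
  assumes "prime p" "p mod 4 = 1"
  shows "\<exists>!x. x \<in> {1..(p - 1) div 2} \<and> p dvd x\<^sup>2 + 1"
proof (rule ex_ex1I)
  have p: "p > 1"
    using assms prime_gt_1_int by blast
  obtain s where s: "p dvd s\<^sup>2 + 1"
    using ex_square_plus_1_dvd[OF assms] .
  define t where "t = s mod p"
  have dvd: "p dvd t\<^sup>2 + 1"
  proof -
    have "[t\<^sup>2 + 1 = s\<^sup>2 + 1] (mod p)"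
      unfolding t_def by (intro cong_add cong_pow cong_refl) simp
    then show ?thesis
      using s cong_dvd_iff by blast
  qed
  have t: "0 \<le> t" "t < p"
    using p by (auto simp: t_def)
  have "t \<noteq> 0"
    using dvd p by auto
  have "(p - t)\<^sup>2 + 1 = p * (p - 2 * t) + (t\<^sup>2 + 1)"
    by (simp add: power2_eq_square algebra_simps)
  then have "p dvd (p - t)\<^sup>2 + 1"
    using dvd by (metis dvd_add dvd_triv_left)
  moreover have "t \<in> {1..(p - 1) div 2} \<or> p - t \<in> {1..(p - 1) div 2}"
  proof -
    have "p = 2 * ((p - 1) div 2) + 1"
      using assms(2) by presburger
    then show ?thesis
      using t \<open>t \<noteq> 0\<close> by (simp only: atLeastAtMost_iff) linarith
  qed
  ultimately show "\<exists>x. x \<in> {1..(p - 1) div 2} \<and> p dvd x\<^sup>2 + 1"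
    using dvd by blast
next
  fix x y
  assume x: "x \<in> {1..(p - 1) div 2} \<and> p dvd x\<^sup>2 + 1" and y: "y \<in> {1..(p - 1) div 2} \<and> p dvd y\<^sup>2 + 1"
  have "p dvd (x\<^sup>2 + 1) - (y\<^sup>2 + 1)"
    using x y by (intro dvd_diff) auto
  also have "(x\<^sup>2 + 1) - (y\<^sup>2 + 1) = (x - y) * (x + y)"
    by (simp add: power2_eq_square algebra_simps)
  finally have "p dvd x - y \<or> p dvd x + y"
    using assms(1) prime_dvd_mult_iff by blast
  \<comment> \<open>Two members of the lower half have a positive sum of at most
    \<open>p - 1\<close>.\<close>
  moreover have "\<not> p dvd x + y"
    using x y zdvd_imp_le[of p "x + y"] by auto
  ultimately have "p dvd x - y"
    by simp
  moreover have "\<bar>x - y\<bar> < p"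
    using x y by auto
  ultimately show "x = y"
    using dvd_imp_le_int[of "x - y" p] by auto
qed

lemma sum_Legendre_cubic_1_mod_4:
  fixes p :: int
  assumes "prime p" "p mod 4 = 1"
  shows "(\<Sum>x\<in>{0..<p}. Legendre (cubic x) p) \<noteq> 0"
proof -
  define h where "h = (p - 1) div 2"
  have p: "p > 1"
    using assms prime_gt_1_int by blast
  have h: "p = 2 * h + 1" "even h" "h > 0"
    using assms p unfolding h_def by presburger+
  let ?f = "\<lambda>x. Legendre (cubic x) p"
  let ?T = "\<Sum>x\<in>{1..h}. ?f x"
  \<comment> \<open>The reflection exchanges the two halves, and as -1 is a residue it preserves the
    summands.\<close>
  have "{1..p - 1} = {1..h} \<union> {p - h..p - 1}"
    using h by auto
  then have "(\<Sum>x\<in>{1..p - 1}. ?f x) = ?T + (\<Sum>x\<in>{p - h..p - 1}. ?f x)"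
    using h by (simp add: sum.union_disjoint)
  also have "(\<Sum>x\<in>{p - h..p - 1}. ?f x) = ?T"
    using sum_Legendre_cubic_reflect[of p "p - h" "p - 1"] assms
    by (simp add: Legendre_minus_1_mod_4)
  finally have S: "(\<Sum>x\<in>{0..<p}. ?f x) = 2 * ?T"
    using sum_Legendre_cubic_residues[of p] p by simp
  obtain i where i: "i \<in> {1..h}" "p dvd i\<^sup>2 + 1"
    "\<And>x. x \<in> {1..h} \<Longrightarrow> p dvd x\<^sup>2 + 1 \<Longrightarrow> x = i"
    using ex1_half_square_plus_1_dvd[OF assms] unfolding h_def by blast
  \<comment> \<open>A symbol is odd unless it is 0. In this range \<open>p\<close> does not divide
    \<open>x\<close>, so only the root \<open>i\<close> of -1 gives 0.\<close>
  have "odd (?f x) \<longleftrightarrow> x \<noteq> i" if "x \<in> {1..h}" for x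
  proof -
    have "odd (?f x) \<longleftrightarrow> ?f x \<noteq> 0"
      using Legendre_cases[of "cubic x" p] by auto
    also have "\<dots> \<longleftrightarrow> \<not> p dvd x\<^sup>2 + 1"
      using assms(1) that h zdvd_imp_le[of p x]
      by (auto simp: Legendre_eq_0_iff cubic_def prime_dvd_mult_iff)
    also have "\<dots> \<longleftrightarrow> x \<noteq> i"
      using that i by blast
    finally show ?thesis .
  qed
  then have "{x \<in> {1..h}. odd (?f x)} = {1..h} - {i}"
    by auto
  then have "card {x \<in> {1..h}. odd (?f x)} = nat h - 1"
    using i(1) by simp
  then have "odd (card {x \<in> {1..h}. odd (?f x)})"
    using h by (simp add: even_nat_iff)
  \<comment> \<open>A sum has the parity of its number of odd summands, here \<open>h - 1\<close>
    with \<open>h\<close> even.\<close>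
  then have "odd ?T"
    by (simp add: even_sum_iff)
  then show ?thesis
    using S by auto
qed

section \<open>Nonvanishing of the character sum\<close>

lemma cubic_sum_prime_power_neq_0_iff:
  fixes p :: int
  assumes "prime p" "odd p" "k > 0"
  shows "cubic_sum (p ^ k) \<noteq> 0 \<longleftrightarrow> (p mod 4 = 3 \<longrightarrow> even k)"
proof -
  have "p \<noteq> 0"
    using assms(2) by auto
  then have "cubic_sum (p ^ k) \<noteq> 0 \<longleftrightarrow> (\<Sum>x\<in>{0..<p}. Legendre (cubic x) p ^ k) \<noteq> 0"
    using cubic_sum_prime_power[OF assms(1,3)] by simp
  also have "\<dots> \<longleftrightarrow> (p mod 4 = 3 \<longrightarrow> even k)"
  proof (cases "even k")
    case True
    then show ?thesis
      using sum_Legendre_cubic_even_power[OF assms(1,2), of k] by simp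
  next
    case False
    have "p mod 4 = 1 \<or> p mod 4 = 3"
      using assms(2) by presburger
    then show ?thesis
      using False assms(1) sum_Legendre_cubic_3_mod_4 sum_Legendre_cubic_1_mod_4
      by (auto simp: Legendre_odd_power)
  qed
  finally show ?thesis .
qed

text \<open>Splitting off a prime power imposes the same condition on both sides: an even exponent
  if the prime is 3 modulo 4, and nothing otherwise.\<close>

lemma cubic_sum_neq_0_iff:
  assumes "n > 0" "odd n"
  shows "cubic_sum n \<noteq> 0 \<longleftrightarrow> even_mult_3_mod_4 n"
  using assms
proof (induction rule: int_prime_power_induct)
  case 1
  have "{0..<1} = {0 :: int}"
    by auto
  then show ?case
    by (simp add: cubic_sum_def Jacobi_def even_mult_3_mod_4_def)
next
  case (mult p k m)
  have "odd p" "odd m"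
    using mult.prems mult.hyps by auto
  have "coprime (p ^ k) m"
    using mult.hyps prime_imp_coprime by simp
  then have "cubic_sum (p ^ k * m) = cubic_sum (p ^ k) * cubic_sum m"
    using mult.hyps prime_gt_0_int by (intro cubic_sum_mult) auto
  then show ?case
    using cubic_sum_prime_power_neq_0_iff[OF \<open>prime p\<close> \<open>odd p\<close> \<open>k > 0\<close>] mult.IH[OF \<open>odd m\<close>]
      even_mult_3_mod_4_prime_power_mult[of p m k] mult.hyps by simp
qed

theorem theorem5p1:
  fixes n :: int
  assumes "n > 1"
    and "[n = 1] (mod 4)"
  shows "\<not> (\<exists>a b :: int. n = a\<^sup>2 + b\<^sup>2) \<longleftrightarrow>
    (\<Sum>x = 0..n - 1. Jacobi (x * (x\<^sup>2 + 1)) n) = 0"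
proof -
  have "odd n"
    using assms(2) by (simp add: cong_def) presburger
  have "{0..n - 1} = {0..<n}"
    by auto
  then have "(\<Sum>x = 0..n - 1. Jacobi (x * (x\<^sup>2 + 1)) n) = cubic_sum n"
    by (simp add: cubic_sum_def cubic_def)
  moreover have "(\<exists>a b :: int. n = a\<^sup>2 + b\<^sup>2) \<longleftrightarrow> cubic_sum n \<noteq> 0"
    using sum_two_squares_iff[of n] cubic_sum_neq_0_iff[of n] \<open>odd n\<close> assms(1)
    by (simp add: sum_two_squares_def)
  ultimately show ?thesis
    by simp
qed

end
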